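(* Consider the discrete-time linear system $x_{k+1}=Ax_k+Bu_k+Ew_k$, $y_k=Cx_k+Dw_k$, with $x_k\in\mathbb{R}^n$, $u_k\in\mathbb{R}^m$, $w_k\in\mathbb{R}^r$, $y_k\in\mathbb{R}^p$. Assume the system is controllable and observable and that $A$ is Schur stable, and let $\nu\in\mathbb{Z}_{>0}$ be its observability index. Let $G:=C(I-A)^{-1}B$. Let $y_{[0,T]}$ be the output data (with corresponding state sequence $x_{[0,T]}$) generated by the system when $u_{[0,T]}$, $w_{[0,T]}$ are applied as inputs, assume that $u_{[0,T-1]}$ and $w_{[0,T-1]}$ are persistently exciting signals of order $n+\nu$, and let $q:=T-\nu+1$. Let $\hat M\in\mathbb{R}^{q\times m}$ be any matrix that satisfies $$Y^{\mathrm{diff}}_{\nu,q}\hat M=0,\qquad U_{\nu,q}\hat M=\mathbf{1}_\nu\otimes I_m .$$ If $\hat G$ is computed as $\hat G:=[Y_{\nu,q}]_i\hat M$, for any $i\in\{1,\dots,\nu\}$, then $$\hat G-G=CA\big([X_{\nu,q}]_i\hat M-(I-A)^{-1}B\big)+(CE+D)[W_{\nu,q}]_i\hat M+D[W^{\mathrm{diff}}_{\nu,q}]_i\hat M .$$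
   Context: For a signal $z_k\in\mathbb{R}^\sigma$, write $z_{[0,T-1]}=(z_0,\dots,z_{T-1})$. For $t\le T$ and $q\le T-t+1$, the Hankel matrix of length $t$ with $q$ columns associated with $z_{[0,T-1]}$ is the matrix $Z_{t,q}\in\mathbb{R}^{\sigma t\times q}$ whose $i$-th block-row ($i=1,\dots,t$) is $[Z_{t,q}]_i=[z_{i-1},z_i,\dots,z_{i+q-2}]$. The signal $z_{[0,T-1]}$ is persistently exciting of order $t$ if $Z_{t,q}$ has full row rank $\sigma t$ (for some $q\le T-t+1$, equivalently for $q=T-t+1$). $U_{\nu,q},W_{\nu,q},X_{\nu,q},Y_{\nu,q}$ are the Hankel matrices associated with $u_{[0,T-1]}$, $w_{[0,T-1]}$, $x_{[0,T-1]}$, $y_{[0,T-1]}$. $Y^{\mathrm{diff}}_{\nu,q}$ and $W^{\mathrm{diff}}_{\nu,q}$ are the Hankel matrices associated with the $T$-long difference signals $y^{\mathrm{diff}}=(y_1-y_0,\dots,y_T-y_{T-1})$ and $w^{\mathrm{diff}}=(w_1-w_0,\dots,w_T-w_{T-1})$. The system is controllable if $[B,AB,\dots,A^{\theta-1}B]$ has rank $n$ for some $\theta$, and observable if $\mathcal{O}_\nu=[C^\top,A^\top C^\top,\dots,(A^\top)^{\nu-1}C^\top]^\top$ has rank $n$ for some $\nu$; the smallest such $\nu$ is the observability index. $A$ is Schur stable if all its eigenvalues lie in the open unit disk. $\mathbf{1}_\nu\in\mathbb{R}^\nu$ is the all-ones vector, and $\otimes$ is the Kronecker product. *)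

theory Defs
  imports
    Complex_Main
    "Jordan_Normal_Form.Gauss_Jordan_Elimination"
    "Jordan_Normal_Form.Char_Poly"
    "Jordan_Normal_Form.DL_Rank"
begin

definition mat_rank :: "'a :: field mat \<Rightarrow> nat" where
  "mat_rank A = vec_space.rank (dim_row A) A"

text \<open>The library returns the inverse as an option; the value is meaningful for invertible matrices.\<close>

definition mat_inv :: "'a :: field mat \<Rightarrow> 'a mat" where
  "mat_inv A = the (mat_inverse A)"

definition kron :: "'a :: semiring_1 mat \<Rightarrow> 'a mat \<Rightarrow> 'a mat" where
  "kron A B = mat (dim_row A * dim_row B) (dim_col A * dim_col B)
     (\<lambda>(i, j). A $$ (i div dim_row B, j div dim_col B) * B $$ (i mod dim_row B, j mod dim_col B))"

definition ones_col :: "nat \<Rightarrow> real mat" where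
  "ones_col \<nu> = mat \<nu> 1 (\<lambda>_. 1)"

text \<open>A signal with values in dimension \<open>\<sigma>\<close> is a function \<open>z\<close> on time; finite-horizon signals
  only constrain the values of \<open>z\<close> on that horizon. \<open>hankel \<sigma> z t q\<close> reads exactly the samples
  \<open>z 0, \<dots>, z (t + q - 2)\<close>, so for a signal of length \<open>T\<close> it is to be used with
  \<open>t \<le> T\<close> and \<open>q + t \<le> T + 1\<close>. With 0-based indices, row \<open>i\<close> is component \<open>i mod \<sigma>\<close> of block-row
  \<open>i div \<sigma>\<close>.\<close>

definition hankel :: "nat \<Rightarrow> (nat \<Rightarrow> real vec) \<Rightarrow> nat \<Rightarrow> nat \<Rightarrow> real mat" where
  "hankel \<sigma> z t q = mat (\<sigma> * t) q (\<lambda>(i, j). z (i div \<sigma> + j) $ (i mod \<sigma>))"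

text \<open>The \<open>i\<close>-th block-row of height \<open>\<sigma>\<close>, with \<open>i\<close> counted from 1.\<close>

definition block_row :: "nat \<Rightarrow> real mat \<Rightarrow> nat \<Rightarrow> real mat" where
  "block_row \<sigma> Z i = mat \<sigma> (dim_col Z) (\<lambda>(a, j). Z $$ ((i - 1) * \<sigma> + a, j))"

definition diff_signal :: "(nat \<Rightarrow> real vec) \<Rightarrow> nat \<Rightarrow> real vec" where
  "diff_signal z k = z (Suc k) - z k"

text \<open>\<open>persistently_exciting \<sigma> T z t\<close>: the signal \<open>z 0, \<dots>, z (T - 1)\<close> is persistently exciting
  of order \<open>t\<close>.\<close>

definition persistently_exciting :: "nat \<Rightarrow> nat \<Rightarrow> (nat \<Rightarrow> real vec) \<Rightarrow> nat \<Rightarrow> bool" where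
  "persistently_exciting \<sigma> T z t \<longleftrightarrow>
     t \<le> T \<and> (\<exists>q \<le> T - t + 1. mat_rank (hankel \<sigma> z t q) = \<sigma> * t)"

text \<open>The block matrix \<open>[B, A B, \<dots>, A^(\<theta>-1) B]\<close>.\<close>

definition ctrb_mat :: "real mat \<Rightarrow> real mat \<Rightarrow> nat \<Rightarrow> real mat" where
  "ctrb_mat A B \<theta> = mat (dim_row A) (dim_col B * \<theta>)
     (\<lambda>(i, j). (A ^\<^sub>m (j div dim_col B) * B) $$ (i, j mod dim_col B))"

text \<open>\<open>[C\<^sup>T, A\<^sup>T C\<^sup>T, \<dots>, (A\<^sup>T)^(\<nu>-1) C\<^sup>T]\<^sup>T\<close>.\<close>

definition obsv_mat :: "real mat \<Rightarrow> real mat \<Rightarrow> nat \<Rightarrow> real mat" where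
  "obsv_mat A C \<nu> = transpose_mat (ctrb_mat (transpose_mat A) (transpose_mat C) \<nu>)"

definition controllable :: "real mat \<Rightarrow> real mat \<Rightarrow> bool" where
  "controllable A B \<longleftrightarrow> (\<exists>\<theta> > 0. mat_rank (ctrb_mat A B \<theta>) = dim_row A)"

definition observable :: "real mat \<Rightarrow> real mat \<Rightarrow> bool" where
  "observable A C \<longleftrightarrow> (\<exists>\<nu> > 0. mat_rank (obsv_mat A C \<nu>) = dim_row A)"

definition observability_index :: "real mat \<Rightarrow> real mat \<Rightarrow> nat" where
  "observability_index A C = (LEAST \<nu>. \<nu> > 0 \<and> mat_rank (obsv_mat A C \<nu>) = dim_row A)"

text \<open>Eigenvalues are the complex ones.\<close>

definition schur_stable :: "real mat \<Rightarrow> bool" where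
  "schur_stable A \<longleftrightarrow> (\<forall>l. eigenvalue (map_mat complex_of_real A) l \<longrightarrow> cmod l < 1)"

end

theory Submission
  imports Defs
begin

text \<open>Fix a block-row \<open>i\<close> and write \<open>X\<close>, \<open>X'\<close>, \<open>U\<close>, \<open>W\<close>, \<open>Y\<close>, \<open>Y'\<close> for that block-row of
  the Hankel matrices of the state, of the state one step later, and so on, multiplied from the
  right by \<open>Mhat\<close>. The system equations hold column by column and are linear, so they survive
  this multiplication (\<open>block_row_hankel_add\<close>, \<open>block_row_hankel_mult_vec\<close>):
  \<open>X' = A X + B U + E W\<close> and \<open>Y' = C X' + D (W + W_diff)\<close>. The two conditions on \<open>Mhat\<close> say
  \<open>Y' - Y = 0\<close> (the combined trajectory has a stationary output) and \<open>U = I\<close> (unit input), so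
  \<open>Y = Y' = C A X + C B + (C E + D) W + D W_diff\<close>.

  For the gain, stability makes \<open>I - A\<close> invertible (\<open>schur_stable_det\<close>), and its inverse \<open>P\<close>
  satisfies \<open>P = I + A P\<close> (\<open>mat_inv_one_minus\<close>), hence \<open>G = C B + C A P B\<close>. In \<open>Y - G\<close> the
  term \<open>C B\<close> cancels and the claimed formula remains. Persistency of excitation supplies
  \<open>\<nu> \<le> T\<close>, which keeps every sample that is read inside the horizon.\<close>

section \<open>Invertibility of I - A\<close>

lemma mat_inv_mult:
  fixes A :: "'a :: field mat"
  assumes A: "A \<in> carrier_mat n n" and "det A \<noteq> 0"
  shows "mat_inv A \<in> carrier_mat n n" "A * mat_inv A = 1\<^sub>m n"
proof -
  have "A \<in> Units (ring_mat TYPE('a) n ())"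
    using det_non_zero_imp_unit[OF assms] .
  then obtain P where "mat_inverse A = Some P"
    using mat_inverse(1)[OF A, where b = "()"] by (cases "mat_inverse A") auto
  with mat_inverse(2)[OF A this]
  show "mat_inv A \<in> carrier_mat n n" "A * mat_inv A = 1\<^sub>m n"
    by (auto simp: mat_inv_def)
qed

text \<open>A vanishing determinant would make 1 an eigenvalue, and 1 lies outside the open unit disk.
  Stability speaks of complex eigenvalues, so the determinant is taken over the complex numbers.\<close>

lemma schur_stable_det:
  assumes A: "A \<in> carrier_mat n n" and "schur_stable A"
  shows "det (1\<^sub>m n - A) \<noteq> 0"
proof
  let ?c = "map_mat complex_of_real"
  assume 0: "det (1\<^sub>m n - A) = 0"
  have "char_matrix (?c A) 1 = - 1 \<cdot>\<^sub>m ?c (1\<^sub>m n - A)"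
    using A by (intro eq_matI) (auto simp: char_matrix_def)
  then have "det (char_matrix (?c A) 1) = (- 1) ^ n * complex_of_real (det (1\<^sub>m n - A))"
    using A by (simp add: det_smult of_real_hom.hom_det)
  with 0 A have "eigenvalue (?c A) 1"
    by (subst eigenvalue_det[of _ n]) auto
  with \<open>schur_stable A\<close> show False
    by (auto simp: schur_stable_def)
qed

text \<open>One step of the Neumann series.\<close>

lemma mat_inv_one_minus:
  fixes A :: "'a :: field mat"
  assumes A: "A \<in> carrier_mat n n" and d: "det (1\<^sub>m n - A) \<noteq> 0"
  shows "mat_inv (1\<^sub>m n - A) = 1\<^sub>m n + A * mat_inv (1\<^sub>m n - A)" (is "?P = _")
proof -
  have P: "?P \<in> carrier_mat n n" and inv: "(1\<^sub>m n - A) * ?P = 1\<^sub>m n"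
    using mat_inv_mult[OF minus_carrier_mat[OF A] d] by auto
  have "1\<^sub>m n = ?P - A * ?P"
    using inv minus_mult_distrib_mat[OF one_carrier_mat A P] P by simp
  moreover have "?P = (?P - A * ?P) + A * ?P"
    using A P by (intro eq_matI) auto
  ultimately show ?thesis
    by simp
qed

section \<open>Block-rows of Hankel matrices\<close>

lemma block_row_carrier [simp]: "block_row \<sigma> Z i \<in> carrier_mat \<sigma> (dim_col Z)"
  by (simp add: block_row_def)

lemma dim_hankel [simp]: "dim_row (hankel \<sigma> z t q) = \<sigma> * t" "dim_col (hankel \<sigma> z t q) = q"
  by (simp_all add: hankel_def)

lemma block_index_less:
  fixes a i \<sigma> t :: nat
  assumes "i \<in> {1..t}" "a < \<sigma>"
  shows "(i - 1) * \<sigma> + a < \<sigma> * t"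
proof -
  have "(i - 1) * \<sigma> + a < Suc (i - 1) * \<sigma>"
    using assms(2) unfolding mult_Suc by linarith
  also have "\<dots> \<le> t * \<sigma>"
    using assms by (intro mult_right_mono) auto
  finally show ?thesis
    by (simp add: mult.commute)
qed

lemma block_row_hankel:
  assumes "i \<in> {1..t}"
  shows "block_row \<sigma> (hankel \<sigma> z t q) i = mat \<sigma> q (\<lambda>(a, j). z (i - 1 + j) $ a)"
  using block_index_less[OF assms]
  by (intro eq_matI) (auto simp: block_row_def hankel_def)

lemma block_row_mult:
  assumes "Z \<in> carrier_mat (\<sigma> * t) q" "M \<in> carrier_mat q k" "i \<in> {1..t}"
  shows "block_row \<sigma> (Z * M) i = block_row \<sigma> Z i * M"
  using assms block_index_less[OF assms(3)]
  by (intro eq_matI) (auto simp: block_row_def scalar_prod_def)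

lemma block_row_zero:
  assumes "i \<in> {1..t}"
  shows "block_row \<sigma> (0\<^sub>m (\<sigma> * t) k) i = 0\<^sub>m \<sigma> k"
  using block_index_less[OF assms] by (intro eq_matI) (auto simp: block_row_def)

lemma block_row_kron_ones:
  assumes "i \<in> {1..t}"
  shows "block_row k (kron (ones_col t) (1\<^sub>m k)) i = 1\<^sub>m k"
proof (intro eq_matI)
  fix a j assume "a < dim_row (1\<^sub>m k :: real mat)" "j < dim_col (1\<^sub>m k :: real mat)"
  then have "a < k" "j < k"
    by auto
  moreover have "(i - 1) * k + a < t * k"
    using block_index_less[OF assms \<open>a < k\<close>] by (simp add: mult.commute)
  ultimately show "block_row k (kron (ones_col t) (1\<^sub>m k)) i $$ (a, j) = 1\<^sub>m k $$ (a, j)"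
    using assms by (auto simp: block_row_def kron_def ones_col_def)
qed (auto simp: block_row_def kron_def ones_col_def)

lemma block_row_hankel_diff:
  assumes i: "i \<in> {1..t}" and z: "\<And>j. j \<le> q \<Longrightarrow> z (i - 1 + j) \<in> carrier_vec \<sigma>"
  shows "block_row \<sigma> (hankel \<sigma> (diff_signal z) t q) i =
    block_row \<sigma> (hankel \<sigma> (\<lambda>k. z (Suc k)) t q) i - block_row \<sigma> (hankel \<sigma> z t q) i"
  unfolding block_row_hankel[OF i]
proof (intro eq_matI)
  fix a j assume "a < dim_row (mat \<sigma> q (\<lambda>(a, j). z (Suc (i - 1 + j)) $ a)
      - mat \<sigma> q (\<lambda>(a, j). z (i - 1 + j) $ a))"
    and "j < dim_col (mat \<sigma> q (\<lambda>(a, j). z (Suc (i - 1 + j)) $ a)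
      - mat \<sigma> q (\<lambda>(a, j). z (i - 1 + j) $ a))"
  then have "a < \<sigma>" "j < q"
    by auto
  with z[of j] z[of "Suc j"]
  show "mat \<sigma> q (\<lambda>(a, j). diff_signal z (i - 1 + j) $ a) $$ (a, j) =
      (mat \<sigma> q (\<lambda>(a, j). z (Suc (i - 1 + j)) $ a)
      - mat \<sigma> q (\<lambda>(a, j). z (i - 1 + j) $ a)) $$ (a, j)"
    by (auto simp: diff_signal_def)
qed auto

text \<open>A linear relation between signals at each time is the same relation between block-rows,
  since each column of a block-row is one sample.\<close>

lemma block_row_hankel_add:
  assumes i: "i \<in> {1..t}"
    and a: "\<And>j. j < q \<Longrightarrow> a (i - 1 + j) \<in> carrier_vec \<sigma>"
    and b: "\<And>j. j < q \<Longrightarrow> b (i - 1 + j) \<in> carrier_vec \<sigma>"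
    and z: "\<And>j. j < q \<Longrightarrow> z (i - 1 + j) = a (i - 1 + j) + b (i - 1 + j)"
  shows "block_row \<sigma> (hankel \<sigma> z t q) i =
    block_row \<sigma> (hankel \<sigma> a t q) i + block_row \<sigma> (hankel \<sigma> b t q) i"
  unfolding block_row_hankel[OF i] using carrier_vecD[OF a] carrier_vecD[OF b] z
  by (intro eq_matI) auto

lemma block_row_hankel_mult_vec:
  assumes i: "i \<in> {1..t}" and K: "K \<in> carrier_mat \<sigma> \<rho>"
    and z: "\<And>j. j < q \<Longrightarrow> z (i - 1 + j) \<in> carrier_vec \<rho>"
  shows "block_row \<sigma> (hankel \<sigma> (\<lambda>k. K *\<^sub>v z k) t q) i = K * block_row \<rho> (hankel \<rho> z t q) i"
  unfolding block_row_hankel[OF i] using K carrier_vecD[OF z]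
  by (intro eq_matI) (auto simp: scalar_prod_def)

section \<open>The error of the estimated gain\<close>

theorem propositionV3:
  fixes n m r p \<nu> T q i :: nat
    and A B E C D G Mhat Ghat :: "real mat"
    and x u w y :: "nat \<Rightarrow> real vec"
  assumes A: "A \<in> carrier_mat n n"
    and B: "B \<in> carrier_mat n m"
    and E: "E \<in> carrier_mat n r"
    and C: "C \<in> carrier_mat p n"
    and D: "D \<in> carrier_mat p r"
    and x: "\<And>k. k \<le> T \<Longrightarrow> x k \<in> carrier_vec n"
    and u: "\<And>k. k \<le> T \<Longrightarrow> u k \<in> carrier_vec m"
    and w: "\<And>k. k \<le> T \<Longrightarrow> w k \<in> carrier_vec r"
    and state_eq: "\<And>k. k < T \<Longrightarrow> x (Suc k) = A *\<^sub>v x k + B *\<^sub>v u k + E *\<^sub>v w k"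
    and output_eq: "\<And>k. k \<le> T \<Longrightarrow> y k = C *\<^sub>v x k + D *\<^sub>v w k"
    and "controllable A B"
    and "observable A C"
    and "schur_stable A"
    and "\<nu> = observability_index A C"
    and "\<nu> > 0"
    and G: "G = C * mat_inv (1\<^sub>m n - A) * B"
    and "persistently_exciting m T u (n + \<nu>)"
    and "persistently_exciting r T w (n + \<nu>)"
    and q: "q = T - \<nu> + 1"
    and Mhat: "Mhat \<in> carrier_mat q m"
    and "hankel p (diff_signal y) \<nu> q * Mhat = 0\<^sub>m (p * \<nu>) m"
    and "hankel m u \<nu> q * Mhat = kron (ones_col \<nu>) (1\<^sub>m m)"
    and i: "i \<in> {1..\<nu>}"
    and Ghat: "Ghat = block_row p (hankel p y \<nu> q) i * Mhat"
  shows "Ghat - G =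
      C * A * (block_row n (hankel n x \<nu> q) i * Mhat - mat_inv (1\<^sub>m n - A) * B)
    + (C * E + D) * (block_row r (hankel r w \<nu> q) i * Mhat)
    + D * (block_row r (hankel r (diff_signal w) \<nu> q) i * Mhat)"
proof -
  let ?h = "\<lambda>\<sigma> z. block_row \<sigma> (hankel \<sigma> z \<nu> q) i"
  define X X' U W Wd Y Y' P where
    "X = ?h n x * Mhat" and "X' = ?h n (\<lambda>k. x (Suc k)) * Mhat" and "U = ?h m u * Mhat"
    and "W = ?h r w * Mhat" and "Wd = ?h r (diff_signal w) * Mhat"
    and "Y = ?h p y * Mhat" and "Y' = ?h p (\<lambda>k. y (Suc k)) * Mhat"
    and "P = mat_inv (1\<^sub>m n - A)"
  note names = X_def X'_def U_def W_def Wd_def Y_def Y'_def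
  have "\<nu> \<le> T"
    using \<open>persistently_exciting m T u (n + \<nu>)\<close> by (simp add: persistently_exciting_def)
  then have horizon: "i - 1 + j < T" if "j < q" for j
    using that i q by auto
  then have horizon': "i - 1 + j \<le> T" if "j \<le> q" for j
    using that q i \<open>\<nu> \<le> T\<close> by auto
  have y: "y k \<in> carrier_vec p" if "k \<le> T" for k
    using output_eq[OF that] C D x[OF that] w[OF that] by auto
  have h [simp]: "?h \<sigma> z \<in> carrier_mat \<sigma> q" for \<sigma> z
    using block_row_carrier[of \<sigma> "hankel \<sigma> z \<nu> q" i] by simp
  have carr [simp]: "X \<in> carrier_mat n m" "X' \<in> carrier_mat n m" "U \<in> carrier_mat m m"
    "W \<in> carrier_mat r m" "Wd \<in> carrier_mat r m" "Y \<in> carrier_mat p m" "Y' \<in> carrier_mat p m"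
    unfolding names by (rule mult_carrier_mat[OF h Mhat])+
  have state: "X' = A * X + B * U + E * W"
  proof -
    have "?h n (\<lambda>k. x (Suc k)) =
        ?h n (\<lambda>k. A *\<^sub>v x k + B *\<^sub>v u k) + ?h n (\<lambda>k. E *\<^sub>v w k)"
      using A B E x u w state_eq horizon by (intro block_row_hankel_add[OF i]) (auto simp: less_imp_le)
    also have "?h n (\<lambda>k. A *\<^sub>v x k + B *\<^sub>v u k) = ?h n (\<lambda>k. A *\<^sub>v x k) + ?h n (\<lambda>k. B *\<^sub>v u k)"
      using A B x u horizon by (intro block_row_hankel_add[OF i]) (auto simp: less_imp_le)
    also have "?h n (\<lambda>k. A *\<^sub>v x k) = A * ?h n x"
      using A x horizon by (intro block_row_hankel_mult_vec[OF i]) (auto simp: less_imp_le)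
    also have "?h n (\<lambda>k. B *\<^sub>v u k) = B * ?h m u"
      using B u horizon by (intro block_row_hankel_mult_vec[OF i]) (auto simp: less_imp_le)
    also have "?h n (\<lambda>k. E *\<^sub>v w k) = E * ?h r w"
      using E w horizon by (intro block_row_hankel_mult_vec[OF i]) (auto simp: less_imp_le)
    finally show ?thesis
      unfolding names using A B E Mhat h
      by (simp add: add_mult_distrib_mat[of _ n q _ _ m] assoc_mult_mat[of _ n _ _ q _ m])
  qed
  have outp: "Y' = C * X' + D * (?h r (\<lambda>k. w (Suc k)) * Mhat)"
  proof -
    have k: "Suc (i - 1 + j) \<le> T" if "j < q" for j
      using horizon[OF that] by simp
    have "?h p (\<lambda>k. y (Suc k)) = ?h p (\<lambda>k. C *\<^sub>v x (Suc k)) + ?h p (\<lambda>k. D *\<^sub>v w (Suc k))"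
      using C D x[OF k] w[OF k] output_eq[OF k] by (intro block_row_hankel_add[OF i]) auto
    also have "?h p (\<lambda>k. C *\<^sub>v x (Suc k)) = C * ?h n (\<lambda>k. x (Suc k))"
      using C x[OF k] by (intro block_row_hankel_mult_vec[OF i]) auto
    also have "?h p (\<lambda>k. D *\<^sub>v w (Suc k)) = D * ?h r (\<lambda>k. w (Suc k))"
      using D w[OF k] by (intro block_row_hankel_mult_vec[OF i]) auto
    finally show ?thesis
      unfolding names using C D Mhat h
      by (simp add: add_mult_distrib_mat[of _ p q _ _ m] assoc_mult_mat[of _ p _ _ q _ m])
  qed
  have Wd: "?h r (\<lambda>k. w (Suc k)) * Mhat = W + Wd"
  proof -
    have "Wd = ?h r (\<lambda>k. w (Suc k)) * Mhat - W"
      unfolding names using block_row_hankel_diff[OF i, of q w r] w[OF horizon'] Mhat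
      by (simp add: minus_mult_distrib_mat[of _ r q _ _ m])
    then show ?thesis
      using carrier_matD[OF mult_carrier_mat[OF h Mhat, of r "\<lambda>k. w (Suc k)"]]
        carrier_matD[OF carr(4)]
      by (intro eq_matI) auto
  qed
  have "Y' - Y = block_row p (hankel p (diff_signal y) \<nu> q) i * Mhat"
    unfolding names using block_row_hankel_diff[OF i, of q y p] y[OF horizon'] Mhat
    by (simp add: minus_mult_distrib_mat[of _ p q _ _ m])
  also have "\<dots> = block_row p (hankel p (diff_signal y) \<nu> q * Mhat) i"
    by (rule block_row_mult[OF _ Mhat i, symmetric]) (simp add: hankel_def)
  also have "\<dots> = 0\<^sub>m p m"
    using \<open>hankel p (diff_signal y) \<nu> q * Mhat = 0\<^sub>m (p * \<nu>) m\<close> block_row_zero[OF i] by simp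
  finally have "Y' - Y = 0\<^sub>m p m" .
  moreover have "Y = Y' - (Y' - Y)"
    using carrier_matD[OF carr(6)] carrier_matD[OF carr(7)] by (intro eq_matI) auto
  ultimately have "Y = Y' - 0\<^sub>m p m"
    by metis
  also have "\<dots> = Y'"
    using carrier_matD[OF carr(7)] by (intro eq_matI) auto
  finally have stationary: "Y = Y'" .
  have "U = block_row m (hankel m u \<nu> q * Mhat) i"
    unfolding U_def by (rule block_row_mult[OF _ Mhat i, symmetric]) (simp add: hankel_def)
  then have unit_input: "U = 1\<^sub>m m"
    using \<open>hankel m u \<nu> q * Mhat = kron (ones_col \<nu>) (1\<^sub>m m)\<close> block_row_kron_ones[OF i] by simp

  \<comment> \<open>By stationarity the output may be read one step later, where the state equation brings in
    the input and thereby the term \<open>C B\<close> of the gain.\<close>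
  have Y: "Y = C * (A * X + B + E * W) + D * (W + Wd)"
    using outp stationary state unit_input Wd B by simp
  have d: "det (1\<^sub>m n - A) \<noteq> 0"
    using schur_stable_det[OF A \<open>schur_stable A\<close>] .
  have P: "P \<in> carrier_mat n n"
    unfolding P_def using A by (intro mat_inv_mult(1)[OF _ d]) auto
  have "C * P * B = C * (1\<^sub>m n + A * P) * B"
    using mat_inv_one_minus[OF A d] by (simp add: P_def)
  also have "\<dots> = C * B + C * A * (P * B)"
    using A B C P
    by (simp add: mult_add_distrib_mat[of _ p n _ n] add_mult_distrib_mat[of _ p n _ _ m]
        assoc_mult_mat[of C p n A n "P * B" m] assoc_mult_mat[of C p n "A * P" n B m]
        assoc_mult_mat[of A n n P n B m])
  finally have gain: "G = C * B + C * A * (P * B)"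
    by (simp add: G P_def)
  have Y_expand: "Y = C * A * X + C * B + C * E * W + (D * W + D * Wd)"
    unfolding Y using A B C D E carr
    by (simp add: mult_add_distrib_mat[of _ p n _ m] mult_add_distrib_mat[of _ p r _ m]
        assoc_mult_mat[of C p n A n X m] assoc_mult_mat[of C p n E r W m])
  have CA: "C * A * (X - P * B) = C * A * X - C * A * (P * B)"
    using A B C P by (intro mult_minus_distrib_mat[of _ p n _ m]) auto
  have CE: "(C * E + D) * W = C * E * W + D * W"
    using C D E by (intro add_mult_distrib_mat[of _ p r _ _ m]) auto
  have terms: "C * A * X \<in> carrier_mat p m" "C * B \<in> carrier_mat p m"
    "C * E * W \<in> carrier_mat p m" "D * W \<in> carrier_mat p m" "D * Wd \<in> carrier_mat p m"
    "C * A * (P * B) \<in> carrier_mat p m"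
    using A B C D E P carr by (auto intro!: mult_carrier_mat)
  have cancel: "M1 + M2 + M3 + (M4 + M5) - (M2 + M6) = M1 - M6 + (M3 + M4) + M5"
    if "M1 \<in> carrier_mat p m" "M2 \<in> carrier_mat p m" "M3 \<in> carrier_mat p m"
      "M4 \<in> carrier_mat p m" "M5 \<in> carrier_mat p m" "M6 \<in> carrier_mat p m"
    for M1 M2 M3 M4 M5 M6 :: "real mat"
    using that[THEN carrier_matD(1)] that[THEN carrier_matD(2)] by (intro eq_matI) auto
  have "Y - G = C * A * (X - P * B) + (C * E + D) * W + D * Wd"
    unfolding Y_expand gain CA CE
    by (rule cancel) (use terms in auto)
  then show ?thesis
    by (simp add: Ghat names P_def)
qed

end
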